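(* Let $\Gamma$ be a finitely generated profinite group with positive rank gradient, and let $A,B$ be finitely generated closed subgroups of infinite index in $\Gamma$. Then there exists an open subgroup $B_0$ of $B$ such that the closed subgroup of $\Gamma$ generated by $A$ and $B_0$ has infinite index in $\Gamma$.
   Context: For profinite groups, only closed subgroups are considered, and generation is topological: $d(U)$ is the minimal cardinality of a subset generating a dense subgroup of $U$, and "finitely generated" means $d<\infty$. The rank gradient of a finitely generated profinite group $\Gamma$ is $\nabla\Gamma=\inf_U\frac{d(U)-1}{[\Gamma:U]}$, where $U$ ranges over the open (equivalently, closed finite index) subgroups of $\Gamma$. *)

theory Defs
  imports "HOL-Analysis.Analysis" "HOL-Algebra.Algebra"
begin

definition totally_disconnected_space :: "'a topology \<Rightarrow> bool" where
  "totally_disconnected_space T \<longleftrightarrow>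
     (\<forall>S. connectedin T S \<longrightarrow> S = {} \<or> (\<exists>x. S = {x}))"

definition profinite_group :: "('a, 'b) monoid_scheme \<Rightarrow> 'a topology \<Rightarrow> bool" where
  "profinite_group G T \<longleftrightarrow>
     group G \<and> topspace T = carrier G \<and>
     continuous_map (prod_topology T T) T (\<lambda>(x, y). x \<otimes>\<^bsub>G\<^esub> y) \<and>
     continuous_map T T (\<lambda>x. inv\<^bsub>G\<^esub> x) \<and>
     compact_space T \<and> Hausdorff_space T \<and> totally_disconnected_space T"

definition closed_subgroup :: "('a, 'b) monoid_scheme \<Rightarrow> 'a topology \<Rightarrow> 'a set \<Rightarrow> bool" where
  "closed_subgroup G T H \<longleftrightarrow> subgroup H G \<and> closedin T H"

definition open_subgroup :: "('a, 'b) monoid_scheme \<Rightarrow> 'a topology \<Rightarrow> 'a set \<Rightarrow> bool" where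
  "open_subgroup G T H \<longleftrightarrow> subgroup H G \<and> openin T H"

definition top_generates :: "('a, 'b) monoid_scheme \<Rightarrow> 'a topology \<Rightarrow> 'a set \<Rightarrow> 'a set \<Rightarrow> bool" where
  "top_generates G T S U \<longleftrightarrow> S \<subseteq> U \<and> T closure_of (generate G S) = U"

definition top_fin_gen :: "('a, 'b) monoid_scheme \<Rightarrow> 'a topology \<Rightarrow> 'a set \<Rightarrow> bool" where
  "top_fin_gen G T U \<longleftrightarrow> (\<exists>S. finite S \<and> top_generates G T S U)"

definition top_rank :: "('a, 'b) monoid_scheme \<Rightarrow> 'a topology \<Rightarrow> 'a set \<Rightarrow> nat" where
  "top_rank G T U = (LEAST n. \<exists>S. finite S \<and> card S = n \<and> top_generates G T S U)"

definition group_index :: "('a, 'b) monoid_scheme \<Rightarrow> 'a set \<Rightarrow> nat" where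
  "group_index G H = card (rcosets\<^bsub>G\<^esub> H)"

definition rank_gradient :: "('a, 'b) monoid_scheme \<Rightarrow> 'a topology \<Rightarrow> real" where
  "rank_gradient G T =
     Inf {(real (top_rank G T U) - 1) / real (group_index G U) | U. open_subgroup G T U}"

end

theory Submission
  imports Defs
begin

text \<open>
  Write \<open>\<mu>\<close> for Haar measure and \<open>d\<close> for the number of generators, and let \<open>\<delta> > 0\<close> be the rank
  gradient. If \<open>V\<close> is open, contains \<open>A\<close>, and the closed subgroup generated by \<open>A\<close> and \<open>B \<inter> V\<close> has
  finite index, then that index is at least \<open>[\<Gamma>:V]\<close>, so Schreier's bound gives
  \<open>\<delta>[\<Gamma>:V] < d(A) + [B : B \<inter> V] d(B)\<close>; that is, \<open>\<delta> < d(A) \<mu>(V) + d(B) \<mu>(VB)\<close>. With \<open>V = NA\<close> for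
  open normal subgroups \<open>N\<close>, it suffices that both \<open>\<mu>(NA)\<close> and \<open>\<mu>(NAB)\<close> become arbitrarily small.

  The first does because \<open>A\<close> has infinite index. For the second, the same estimate inside an open
  subgroup \<open>W\<close> containing \<open>B\<close>, of large index, yields open subgroups of \<open>A\<close> and \<open>B\<close> that generate a
  closed subgroup \<open>H\<close> of infinite index. Finitely many translates \<open>pHq\<close> then cover \<open>AB\<close>.
\<close>

no_notation (ASCII) subset_mset (infix \<open><#\<close> 50)
no_notation eq_closure_of (\<open>closure'_of\<index>\<close>)

section \<open>Cosets and coset densities\<close>

context group
begin

lemma r_coset_eq_iff:
  assumes "subgroup H G" "x \<in> carrier G" "y \<in> carrier G"
  shows "H #> x = H #> y \<longleftrightarrow> x \<otimes> inv y \<in> H"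
  using assms coset_join1 coset_join2 coset_mult_inv1 coset_mult_inv2 subgroup.subset
  by (metis inv_closed m_closed)

lemma rcosets_eq_image: "rcosets H = (#>) H ` carrier G"
  by (auto simp: RCOSETS_def)

lemma finite_image_r_coset:
  assumes "finite (rcosets H)" "Y \<subseteq> carrier G"
  shows "finite ((#>) H ` Y)"
  using assms finite_subset[OF image_mono] by (metis rcosets_eq_image)

lemma group_index_pos:
  assumes "finite (rcosets H)"
  shows "group_index G H > 0"
  using assms by (auto simp: group_index_def card_gt_0_iff rcosets_eq_image)

lemma set_mult_upper1:
  assumes "N \<subseteq> carrier G" "subgroup C G"
  shows "N \<subseteq> N <#> C"
proof -
  have "N <#> {\<one>} \<subseteq> N <#> C"
    using subgroup.one_closed[OF assms(2)] by (intro mono_set_mult) auto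
  then show ?thesis
    using coset_mult_one[OF assms(1)] by (simp add: r_coset_eq_set_mult)
qed

lemma set_mult_upper2:
  assumes "subgroup N G" "C \<subseteq> carrier G"
  shows "C \<subseteq> N <#> C"
proof -
  have "{\<one>} <#> C \<subseteq> N <#> C"
    using subgroup.one_closed[OF assms(1)] by (intro mono_set_mult) auto
  then show ?thesis
    using lcos_mult_one[OF assms(2)] by (simp add: l_coset_eq_set_mult)
qed

lemma set_mult_least:
  assumes "subgroup V G" "N \<subseteq> V" "C \<subseteq> V"
  shows "N <#> C \<subseteq> V"
  using assms subgroup.m_closed[OF assms(1)] by (auto simp: set_mult_def)

lemma rcosets_eq_image_set_mult:
  assumes "subgroup N G" "subgroup V G" "N \<subseteq> V"
  shows "rcosets V = (<#>) V ` (rcosets N)"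
proof -
  have "V <#> (N #> x) = V #> x" if "x \<in> carrier G" for x
    using assms that set_mult_subgroup_idem[OF assms(2) subgroup_incl[OF assms]]
    by (simp add: setmult_rcos_assoc subgroup.subset)
  then show ?thesis
    by (force simp: rcosets_eq_image)
qed

lemma finite_rcosets_supergroup:
  assumes "subgroup N G" "subgroup V G" "N \<subseteq> V" "finite (rcosets N)"
  shows "finite (rcosets V)"
  unfolding rcosets_eq_image_set_mult[OF assms(1-3)] using assms(4) by (rule finite_imageI)

lemma group_index_antimono:
  assumes "subgroup N G" "subgroup V G" "N \<subseteq> V" "finite (rcosets N)"
  shows "group_index G V \<le> group_index G N"
  unfolding group_index_def rcosets_eq_image_set_mult[OF assms(1-3)]
  using assms(4) by (rule card_image_le)

lemma card_image_r_coset_translate: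
  assumes "N \<subseteq> carrier G" "V \<subseteq> carrier G" "y \<in> carrier G"
  shows "card ((#>) N ` (V #> y)) = card ((#>) N ` V)"
proof -
  have "(#>) N ` (V #> y) = (\<lambda>c. c #> y) ` (#>) N ` V"
    using assms by (force simp: r_coset_def[of _ V] image_image coset_mult_assoc subset_iff)
  moreover have "inj_on (\<lambda>c. c #> y) ((#>) N ` V)"
  proof (rule inj_on_inverseI)
    show "c #> y #> inv y = c" if "c \<in> (#>) N ` V" for c
      using that assms by (auto simp: coset_mult_assoc m_assoc subset_iff)
  qed
  ultimately show ?thesis
    by (simp add: card_image)
qed

lemma card_image_r_coset_set_mult:
  assumes N: "subgroup N G" "finite (rcosets N)" and V: "subgroup V G" "N \<subseteq> V"
    and Y: "Y \<subseteq> carrier G"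
  shows "card ((#>) N ` (V <#> Y)) = card ((#>) V ` Y) * card ((#>) N ` V)"
proof -
  let ?C = "(#>) V ` Y"
  note VG = subgroup.subset[OF V(1)] and NG = subgroup.subset[OF N(1)]
  have carrier: "c \<subseteq> carrier G" if "c \<in> ?C" for c
    using that VG Y r_coset_subset_G by blast
  have disjoint: "(#>) N ` c \<inter> (#>) N ` d = {}" if cd: "c \<in> ?C" "d \<in> ?C" "c \<noteq> d" for c d
  proof (rule ccontr)
    assume "(#>) N ` c \<inter> (#>) N ` d \<noteq> {}"
    then obtain x y where xy: "x \<in> c" "y \<in> d" "N #> x = N #> y"
      by blast
    have xyG: "x \<in> carrier G" "y \<in> carrier G"
      using xy cd carrier by blast+
    then have "V #> x = V #> y"
      using xy(3) V(2) r_coset_eq_iff[OF N(1) xyG] r_coset_eq_iff[OF V(1) xyG] by blast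
    moreover have "V #> x = c" "V #> y = d"
      using xy cd Y repr_independence[OF _ _ V(1)] by blast+
    ultimately show False
      using cd(3) by simp
  qed
  have "V <#> Y = \<Union>?C"
    by (auto simp: set_mult_def r_coset_def)
  then have "card ((#>) N ` (V <#> Y)) = card (\<Union>c\<in>?C. (#>) N ` c)"
    by (simp add: image_UN)
  also have "\<dots> = (\<Sum>c\<in>?C. card ((#>) N ` c))"
    using disjoint finite_image_r_coset[OF N(2) carrier]
      finite_image_r_coset[OF finite_rcosets_supergroup[OF N(1) V N(2)] Y]
    by (intro card_UN_disjoint) auto
  also have "\<dots> = (\<Sum>c\<in>?C. card ((#>) N ` V))"
    using card_image_r_coset_translate[OF NG VG] Y by (intro sum.cong) auto
  finally show ?thesis
    by simp
qed

lemma group_index_mult: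
  assumes "subgroup N G" "finite (rcosets N)" "subgroup V G" "N \<subseteq> V"
  shows "group_index G N = group_index G V * card ((#>) N ` V)"
proof -
  have "V <#> carrier G = carrier G"
    using assms(3)
    by (intro equalityI set_mult_least subgroup_self set_mult_upper2 subgroup.subset order_refl)
  then show ?thesis
    using card_image_r_coset_set_mult[OF assms, of "carrier G"]
    by (simp add: group_index_def rcosets_eq_image)
qed

text \<open>If \<open>N\<close> is an open subgroup of a compact group, this is the Haar measure of \<open>NY\<close>.\<close>

definition coset_density :: "'a set \<Rightarrow> 'a set \<Rightarrow> real" where
  "coset_density N Y = card ((#>) N ` Y) / group_index G N"

lemma coset_density_mono:
  assumes "finite (rcosets N)" "Y \<subseteq> Z" "Z \<subseteq> carrier G"
  shows "coset_density N Y \<le> coset_density N Z"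
  unfolding coset_density_def using assms finite_image_r_coset
  by (intro divide_right_mono of_nat_mono card_mono image_mono) auto

lemma coset_density_UN_le:
  assumes "finite I"
  shows "coset_density N (\<Union>i\<in>I. Y i) \<le> (\<Sum>i\<in>I. coset_density N (Y i))"
proof -
  have "card ((#>) N ` (\<Union>i\<in>I. Y i)) \<le> (\<Sum>i\<in>I. card ((#>) N ` Y i))"
    unfolding image_UN by (rule card_UN_le[OF assms])
  then show ?thesis
    unfolding coset_density_def sum_divide_distrib[symmetric] of_nat_sum[symmetric]
    by (intro divide_right_mono of_nat_mono) auto
qed

lemma coset_density_set_mult:
  assumes "subgroup N G" "finite (rcosets N)" "subgroup V G" "N \<subseteq> V" "Y \<subseteq> carrier G"
  shows "coset_density N (V <#> Y) = coset_density V Y"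
proof -
  have "card ((#>) N ` V) > 0"
    using group_index_pos[OF assms(2)] group_index_mult[OF assms(1-4)] by simp
  then show ?thesis
    unfolding coset_density_def card_image_r_coset_set_mult[OF assms]
      group_index_mult[OF assms(1-4)] by simp
qed

lemma coset_density_antimono:
  assumes "subgroup N G" "finite (rcosets N)" "subgroup V G" "N \<subseteq> V" "Y \<subseteq> carrier G"
  shows "coset_density N Y \<le> coset_density V Y"
proof -
  have "coset_density N Y \<le> coset_density N (V <#> Y)"
    using assms subgroup.subset[OF assms(3)]
    by (intro coset_density_mono set_mult_upper2 set_mult_closed)
  then show ?thesis
    by (simp add: coset_density_set_mult[OF assms])
qed

lemma coset_density_subgroup:
  assumes "subgroup N G" "finite (rcosets N)" "subgroup V G" "N \<subseteq> V"
  shows "coset_density N V = 1 / group_index G V"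
proof -
  have "V <#> {\<one>} = V"
    using coset_mult_one[OF subgroup.subset[OF assms(3)]] by (simp add: r_coset_eq_set_mult)
  then show ?thesis
    using coset_density_set_mult[OF assms, of "{\<one>}"] by (simp add: coset_density_def)
qed

lemma coset_density_eq_inverse_index:
  assumes N: "N \<lhd> G" "finite (rcosets N)" and C: "subgroup C G"
  shows "coset_density N C = 1 / group_index G (N <#> C)"
proof -
  have subN: "subgroup N G"
    using N(1) by (rule normal_imp_subgroup)
  have "coset_density N C = coset_density N (N <#> C)"
    using coset_density_set_mult[OF subN N(2) subN order_refl subgroup.subset[OF C]] by simp
  also have "\<dots> = 1 / group_index G (N <#> C)"
    using subN N C mult_norm_subgroup set_mult_upper1[OF subgroup.subset[OF subN]]
    by (intro coset_density_subgroup) auto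
  finally show ?thesis .
qed

lemma coset_density_normal_set_mult:
  assumes N: "N \<lhd> G" "finite (rcosets N)" and A: "subgroup A G" and B: "B \<subseteq> carrier G"
  shows "coset_density (N <#> A) B = coset_density N (A <#> B)"
proof -
  have subN: "subgroup N G"
    using N(1) by (rule normal_imp_subgroup)
  note NG = subgroup.subset[OF subN] and AG = subgroup.subset[OF A]
  have "coset_density (N <#> A) B = coset_density N (N <#> A <#> B)"
    using coset_density_set_mult[OF subN N(2) mult_norm_subgroup[OF N(1) A]
        set_mult_upper1[OF NG A] B] by simp
  also have "\<dots> = coset_density N (N <#> (A <#> B))"
    by (simp add: set_mult_assoc[OF NG AG B])
  also have "\<dots> = coset_density N (A <#> B)"
    using coset_density_set_mult[OF subN N(2) subN order_refl setmult_subset_G[OF AG B]] .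
  finally show ?thesis .
qed

lemma coset_density_translate_le:
  assumes N: "N \<lhd> G" "finite (rcosets N)" and M: "M \<subseteq> carrier G"
    and p: "p \<in> carrier G" and q: "q \<in> carrier G"
  shows "coset_density N (p <# M #> q) \<le> coset_density N M"
proof -
  have NG: "N \<subseteq> carrier G"
    using N(1) normal_imp_subgroup subgroup.subset by blast
  have "N #> (p \<otimes> x \<otimes> q) = p <# (N #> x) #> q" if "x \<in> M" for x
  proof -
    have x: "x \<in> carrier G"
      using that M by blast
    have "N #> (p \<otimes> x \<otimes> q) = (N #> p) #> x #> q"
      using x p q NG by (simp add: coset_mult_assoc)
    also have "N #> p = p <# N"
      using normal.coset_eq[OF N(1)] p by blast
    also have "(p <# N) #> x = p <# (N #> x)"
      using coset_assoc[of p x N] x p NG by simp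
    finally show ?thesis .
  qed
  moreover have "p <# M #> q = (\<lambda>x. p \<otimes> x \<otimes> q) ` M"
    by (auto simp: l_coset_def r_coset_def)
  ultimately have "(#>) N ` (p <# M #> q) = (\<lambda>c. p <# c #> q) ` (#>) N ` M"
    by (simp add: image_image)
  then have "card ((#>) N ` (p <# M #> q)) \<le> card ((#>) N ` M)"
    using card_image_le finite_image_r_coset[OF N(2) M] by metis
  then show ?thesis
    unfolding coset_density_def by (intro divide_right_mono of_nat_mono) auto
qed

section \<open>Products of subgroups\<close>

lemma finite_image_r_coset_if_Int_subset:
  assumes W: "subgroup W G" "finite (rcosets W)" and A: "subgroup A G"
    and H: "subgroup H G" "A \<inter> W \<subseteq> H"
  shows "finite ((#>) H ` A)"
proof -
  note AG = subgroup.subset[OF A]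
  obtain R where R: "R \<subseteq> A" "finite R" "(#>) W ` A = (#>) W ` R"
    using finite_subset_image[OF finite_image_r_coset[OF W(2) AG] order_refl] by blast
  have "(#>) H ` A \<subseteq> (#>) H ` R"
  proof
    fix c assume "c \<in> (#>) H ` A"
    then obtain a where a: "a \<in> A" "c = H #> a"
      by blast
    then obtain r where r: "r \<in> R" "W #> a = W #> r"
      using R(3) by blast
    have carrier: "a \<in> carrier G" "r \<in> carrier G"
      using a(1) r(1) R(1) AG by auto
    have "a \<otimes> inv r \<in> A"
      using a(1) r(1) R(1) subgroup.m_closed[OF A] subgroup.m_inv_closed[OF A] by blast
    then have "a \<otimes> inv r \<in> H"
      using r(2) r_coset_eq_iff[OF W(1) carrier] H(2) by blast
    then have "c = H #> r"
      using a(2) r_coset_eq_iff[OF H(1) carrier] by simp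
    then show "c \<in> (#>) H ` R"
      using r(1) by blast
  qed
  then show ?thesis
    using finite_surj[OF R(2)] by blast
qed

lemma set_mult_subset_translates:
  assumes H: "subgroup H G" and A: "subgroup A G" "finite ((#>) H ` A)"
    and B: "B \<subseteq> carrier G" "finite ((#>) H ` B)"
  obtains P Q where "finite P" "P \<subseteq> carrier G" "finite Q" "Q \<subseteq> carrier G"
    "A <#> B \<subseteq> (\<Union>(p, q)\<in>P \<times> Q. p <# H #> q)"
proof -
  note AG = subgroup.subset[OF A(1)]
  obtain P where P: "P \<subseteq> A" "finite P" "(#>) H ` A = (#>) H ` P"
    using finite_subset_image[OF A(2) order_refl] by blast
  obtain Q where Q: "Q \<subseteq> B" "finite Q" "(#>) H ` B = (#>) H ` Q"
    using finite_subset_image[OF B(2) order_refl] by blast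
  have "a \<otimes> b \<in> (\<Union>(p, q)\<in>m_inv G ` P \<times> Q. p <# H #> q)" if ab: "a \<in> A" "b \<in> B" for a b
  proof -
    obtain p where p: "p \<in> P" "H #> inv a = H #> p"
      using ab(1) P(3) subgroup.m_inv_closed[OF A(1)] by blast
    obtain q where q: "q \<in> Q" "H #> b = H #> q"
      using ab(2) Q(3) by blast
    have carrier: "a \<in> carrier G" "b \<in> carrier G" "p \<in> carrier G" "q \<in> carrier G"
      using ab p q P(1) Q(1) AG B(1) by auto
    define h where "h = inv (inv a \<otimes> inv p) \<otimes> (b \<otimes> inv q)"
    have "inv a \<otimes> inv p \<in> H" "b \<otimes> inv q \<in> H"
      using p q carrier r_coset_eq_iff[OF H] by simp_all
    then have "h \<in> H"
      unfolding h_def using subgroup.m_closed[OF H] subgroup.m_inv_closed[OF H] by blast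
    have "inv p \<otimes> h \<otimes> q = inv p \<otimes> (p \<otimes> (a \<otimes> b))"
      unfolding h_def using carrier by (simp add: inv_mult_group m_assoc)
    also have "\<dots> = a \<otimes> b"
      using carrier by (simp add: m_assoc[symmetric])
    finally have "a \<otimes> b \<in> inv p <# H #> q"
      using \<open>h \<in> H\<close> by (force simp: l_coset_def r_coset_def)
    then show ?thesis
      using p(1) q(1) by blast
  qed
  then have cover: "A <#> B \<subseteq> (\<Union>(p, q)\<in>m_inv G ` P \<times> Q. p <# H #> q)"
    by (auto simp: set_mult_def)
  have "m_inv G ` P \<subseteq> carrier G" "Q \<subseteq> carrier G"
    using P(1) Q(1) AG B(1) by auto
  then show ?thesis
    using that[OF finite_imageI[OF P(2)] _ Q(2) _ cover] by simp
qed

lemma coset_density_set_mult_le_multiple: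
  assumes H: "subgroup H G" and A: "subgroup A G" "finite ((#>) H ` A)"
    and B: "B \<subseteq> carrier G" "finite ((#>) H ` B)"
  obtains k :: nat where
    "\<And>N. N \<lhd> G \<Longrightarrow> finite (rcosets N) \<Longrightarrow> coset_density N (A <#> B) \<le> k * coset_density N H"
proof -
  note HG = subgroup.subset[OF H]
  obtain P Q where P: "finite P" "P \<subseteq> carrier G" and Q: "finite Q" "Q \<subseteq> carrier G"
    and cover: "A <#> B \<subseteq> (\<Union>(p, q)\<in>P \<times> Q. p <# H #> q)"
    using set_mult_subset_translates[OF assms] .
  have "coset_density N (A <#> B) \<le> card (P \<times> Q) * coset_density N H"
    if N: "N \<lhd> G" "finite (rcosets N)" for N
  proof -
    have "p <# H #> q \<subseteq> carrier G" if "p \<in> P" "q \<in> Q" for p q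
      using that P(2) Q(2) HG by (intro r_coset_subset_G l_coset_subset_G) auto
    then have "coset_density N (A <#> B) \<le> coset_density N (\<Union>(p, q)\<in>P \<times> Q. p <# H #> q)"
      by (intro coset_density_mono[OF N(2) cover] UN_least) auto
    also have "\<dots> \<le> (\<Sum>i\<in>P \<times> Q. coset_density N (case i of (p, q) \<Rightarrow> p <# H #> q))"
      using P Q by (intro coset_density_UN_le) simp
    also have "\<dots> \<le> (\<Sum>i\<in>P \<times> Q. coset_density N H)"
      using coset_density_translate_le[OF N HG] P Q by (intro sum_mono) auto
    finally show ?thesis
      by simp
  qed
  then show ?thesis
    by (rule that)
qed

section \<open>Schreier generators\<close>

lemma right_transversal_exists:
  assumes "subgroup V G" "subgroup D G"
  obtains R where "R \<subseteq> D" "\<one> \<in> R" "inj_on ((#>) V) R" "(#>) V ` R = (#>) V ` D"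
proof -
  obtain Q where Q: "Q \<subseteq> D - V" "inj_on ((#>) V) Q" "(#>) V ` (D - V) = (#>) V ` Q"
    using iffD1[OF subset_image_inj order_refl[of "(#>) V ` (D - V)"]] by blast
  have V_iff: "V #> x = V #> \<one> \<longleftrightarrow> x \<in> V" if "x \<in> D" for x
    using that r_coset_eq_iff[OF assms(1)] subgroup.mem_carrier[OF assms(2)] by simp
  show ?thesis
  proof
    show "insert \<one> Q \<subseteq> D"
      using Q(1) subgroup.one_closed[OF assms(2)] by blast
    show "inj_on ((#>) V) (insert \<one> Q)"
      using Q(1,2) V_iff by (auto simp: inj_on_insert)
    show "(#>) V ` insert \<one> Q = (#>) V ` D"
    proof -
      have "(#>) V ` D = (#>) V ` (D - V) \<union> (#>) V ` (D \<inter> V)"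
        by blast
      moreover have "(#>) V ` (D \<inter> V) = {V #> \<one>}"
        using V_iff subgroup.one_closed[OF assms(1)] subgroup.one_closed[OF assms(2)] by fastforce
      ultimately show ?thesis
        using Q(3) by simp
    qed
  qed simp
qed

definition schreier_generators :: "'a set \<Rightarrow> 'a set \<Rightarrow> 'a set \<Rightarrow> 'a set" where
  "schreier_generators V R S =
     {x \<otimes> s \<otimes> inv y | x s y. x \<in> R \<and> s \<in> S \<and> y \<in> R \<and> x \<otimes> s \<otimes> inv y \<in> V}"

lemma schreier_generators_subset: "schreier_generators V R S \<subseteq> V"
  by (auto simp: schreier_generators_def)

lemma finite_card_schreier_generators:
  assumes V: "subgroup V G" and R: "R \<subseteq> carrier G" "finite R" "inj_on ((#>) V) R"
    and S: "S \<subseteq> carrier G" "finite S"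
  shows "finite (schreier_generators V R S)" "card (schreier_generators V R S) \<le> card R * card S"
proof -
  define E where "E = {((x, s), y) \<in> (R \<times> S) \<times> R. x \<otimes> s \<otimes> inv y \<in> V}"
  have "finite E"
    using R(2) S(2) by (intro finite_subset[of E "(R \<times> S) \<times> R"]) (auto simp: E_def)
  have image: "schreier_generators V R S = (\<lambda>((x, s), y). x \<otimes> s \<otimes> inv y) ` E"
    by (force simp: schreier_generators_def E_def)
  then show "finite (schreier_generators V R S)"
    using \<open>finite E\<close> by simp
  \<comment> \<open>\<open>y\<close> is determined by \<open>x\<close> and \<open>s\<close>, as the representative of the coset of \<open>x \<otimes> s\<close>.\<close>
  have "inj_on fst E"
  proof (rule inj_onI)
    fix e f assume "e \<in> E" "f \<in> E" "fst e = fst f"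
    then obtain x s y z where ef: "e = ((x, s), y)" "f = ((x, s), z)"
      and R_S: "x \<in> R" "s \<in> S" "y \<in> R" "z \<in> R"
      and mem_V: "x \<otimes> s \<otimes> inv y \<in> V" "x \<otimes> s \<otimes> inv z \<in> V"
      unfolding E_def by force
    have "V #> y = V #> (x \<otimes> s)" "V #> z = V #> (x \<otimes> s)"
      using R_S mem_V R(1) S(1) r_coset_eq_iff[OF V, of "x \<otimes> s"] by (metis m_closed subsetD)+
    then show "e = f"
      using ef R_S R(3) by (simp add: inj_on_def)
  qed
  have "card (schreier_generators V R S) \<le> card E"
    unfolding image by (rule card_image_le[OF \<open>finite E\<close>])
  also have "\<dots> = card (fst ` E)"
    using \<open>inj_on fst E\<close> by (simp add: card_image)
  also have "\<dots> \<le> card (R \<times> S)"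
    using R(2) S(2) by (intro card_mono) (auto simp: E_def)
  finally show "card (schreier_generators V R S) \<le> card R * card S"
    by (simp add: card_cartesian_product)
qed

lemma generate_subset_if_right_mult_closed:
  assumes S: "S \<subseteq> carrier G" and Y: "\<one> \<in> Y" "Y \<subseteq> carrier G"
    and closed: "\<And>x s. x \<in> Y \<Longrightarrow> s \<in> S \<union> m_inv G ` S \<Longrightarrow> x \<otimes> s \<in> Y"
  shows "generate G S \<subseteq> Y"
proof
  fix g assume g: "g \<in> generate G S"
  then have "\<forall>x\<in>Y. x \<otimes> g \<in> Y"
  proof induction
    case one
    then show ?case
      using Y(2) by auto
  next
    case (eng g h)
    then show ?case
      using Y(2) generate_in_carrier[OF S] by (metis m_assoc subsetD)
  qed (simp_all add: closed)
  then show "g \<in> Y"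
    using Y(1) generate_in_carrier[OF S g] by force
qed

lemma schreier_rewriting:
  assumes V: "subgroup V G" and S: "S \<subseteq> carrier G"
    and R: "R \<subseteq> generate G S" "(#>) V ` R = (#>) V ` generate G S"
    and x: "x \<in> R" and s: "s \<in> S \<union> m_inv G ` S"
  obtains k y where "k \<in> generate G (schreier_generators V R S)" "y \<in> R" "x \<otimes> s = k \<otimes> y"
proof -
  let ?K = "generate G (schreier_generators V R S)"
  have carrier: "x \<in> carrier G" "s \<in> carrier G"
    using x s R(1) S generate_incl[OF S] by auto
  have "s \<in> generate G S"
    using s by (auto intro: generate.incl generate.inv)
  then have "x \<otimes> s \<in> generate G S"
    using x R(1) by (auto intro: generate.eng)
  then obtain y where y: "y \<in> R" "V #> (x \<otimes> s) = V #> y"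
    using R(2) by blast
  have yG: "y \<in> carrier G"
    using y(1) R(1) generate_incl[OF S] by auto
  have mem_V: "x \<otimes> s \<otimes> inv y \<in> V"
    using y(2) carrier yG r_coset_eq_iff[OF V] by simp
  have "x \<otimes> s \<otimes> inv y \<in> ?K"
    using s
  proof
    assume "s \<in> S"
    then show ?thesis
      using x y(1) mem_V by (intro generate.incl) (auto simp: schreier_generators_def)
  next
    assume "s \<in> m_inv G ` S"
    then obtain t where t: "t \<in> S" "s = inv t" "t \<in> carrier G"
      using S by blast
    have inv_eq: "inv (x \<otimes> s \<otimes> inv y) = y \<otimes> t \<otimes> inv x"
      using carrier yG t by (simp add: inv_mult_group m_assoc)
    then have "inv (x \<otimes> s \<otimes> inv y) \<in> schreier_generators V R S"
      using x y(1) t(1) subgroup.m_inv_closed[OF V mem_V] by (auto simp: schreier_generators_def)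
    then have "inv (inv (x \<otimes> s \<otimes> inv y)) \<in> ?K"
      by (rule generate.inv)
    then show ?thesis
      using carrier yG by simp
  qed
  moreover have "x \<otimes> s = x \<otimes> s \<otimes> inv y \<otimes> y"
    using carrier yG by (simp add: m_assoc)
  ultimately show ?thesis
    using that y(1) by blast
qed

lemma generate_subset_schreier_set_mult:
  assumes V: "subgroup V G" and S: "S \<subseteq> carrier G"
    and R: "R \<subseteq> generate G S" "\<one> \<in> R" "(#>) V ` R = (#>) V ` generate G S"
  shows "generate G S \<subseteq> generate G (schreier_generators V R S) <#> R" (is "_ \<subseteq> ?K <#> R")
proof (rule generate_subset_if_right_mult_closed[OF S])
  have KG: "?K \<subseteq> carrier G"
    using schreier_generators_subset subgroup.subset[OF V] by (intro generate_incl) blast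
  have RG: "R \<subseteq> carrier G"
    using R(1) generate_incl[OF S] by blast
  show "?K <#> R \<subseteq> carrier G"
    using KG RG by (rule set_mult_closed)
  show "\<one> \<in> ?K <#> R"
    using R(2) generate.one[of G] by (force simp: set_mult_def)
  fix z s assume "z \<in> ?K <#> R" and s: "s \<in> S \<union> m_inv G ` S"
  then obtain k x where kx: "k \<in> ?K" "x \<in> R" "z = k \<otimes> x"
    by (auto simp: set_mult_def)
  obtain l y where ly: "l \<in> ?K" "y \<in> R" "x \<otimes> s = l \<otimes> y"
    using schreier_rewriting[OF V S R(1,3) kx(2) s] .
  have "s \<in> carrier G"
    using s S by auto
  then have "z \<otimes> s = k \<otimes> l \<otimes> y"
    using kx ly KG RG by (metis m_assoc subsetD)
  then show "z \<otimes> s \<in> ?K <#> R"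
    using generate.eng[OF kx(1) ly(1)] ly(2) by (auto simp: set_mult_def)
qed

lemma generate_schreier_generators:
  assumes V: "subgroup V G" and S: "S \<subseteq> carrier G"
    and R: "R \<subseteq> generate G S" "\<one> \<in> R" "inj_on ((#>) V) R" "(#>) V ` R = (#>) V ` generate G S"
  shows "generate G (schreier_generators V R S) = generate G S \<inter> V" (is "?K = ?D \<inter> V")
proof
  have D: "subgroup ?D G"
    using S by (rule generate_is_subgroup)
  have "x \<otimes> s \<otimes> inv y \<in> ?D" if "x \<in> R" "s \<in> S" "y \<in> R" for x s y
  proof -
    have "x \<in> ?D" "s \<in> ?D" "y \<in> ?D"
      using that R(1) by (auto intro: generate.incl)
    then show ?thesis
      by (intro subgroup.m_closed[OF D] subgroup.m_inv_closed[OF D])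
  qed
  then have "schreier_generators V R S \<subseteq> ?D"
    by (auto simp: schreier_generators_def)
  then show KDV: "?K \<subseteq> ?D \<inter> V"
    using schreier_generators_subset subgroups_Inter_pair[OF D V]
    by (intro generate_subgroup_incl) auto
  show "?D \<inter> V \<subseteq> ?K"
  proof
    fix z assume z: "z \<in> ?D \<inter> V"
    then obtain k x where kx: "k \<in> ?K" "x \<in> R" "z = k \<otimes> x"
      using generate_subset_schreier_set_mult[OF V S R(1,2,4)] by (auto simp: set_mult_def)
    have carrier: "k \<in> carrier G" "x \<in> carrier G"
      using kx KDV R(1) subgroup.mem_carrier[OF V] generate_incl[OF S] by blast+
    have "x = inv k \<otimes> z"
      using kx(3) carrier by (simp add: inv_solve_left)
    then have "x \<in> V"
      using z kx(1) KDV subgroup.m_closed[OF V] subgroup.m_inv_closed[OF V] by blast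
    then have "V #> x = V #> \<one>"
      using r_coset_eq_iff[OF V] carrier by simp
    then have "x = \<one>"
      using inj_onD[OF R(3)] kx(2) R(2) by blast
    then show "z \<in> ?K"
      using kx carrier by simp
  qed
qed

lemma schreier_bound:
  assumes S: "S \<subseteq> carrier G" "finite S" and V: "subgroup V G" "finite ((#>) V ` generate G S)"
  obtains S' where "finite S'" "card S' \<le> card ((#>) V ` generate G S) * card S"
    "generate G S' = generate G S \<inter> V"
proof -
  have D: "subgroup (generate G S) G"
    using S(1) by (rule generate_is_subgroup)
  obtain R where R: "R \<subseteq> generate G S" "\<one> \<in> R" "inj_on ((#>) V) R"
    "(#>) V ` R = (#>) V ` generate G S"
    using right_transversal_exists[OF V(1) D] .
  have "finite R" "card R = card ((#>) V ` generate G S)"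
    using R(3,4) V(2) finite_image_iff card_image by metis+
  then show ?thesis
    using finite_card_schreier_generators[OF V(1) _ _ R(3) S]
      generate_schreier_generators[OF V(1) S(1) R] R(1) subgroup.subset[OF D] that
    by (metis order_trans)
qed

section \<open>Syntactic kernels\<close>

text \<open>The class of \<open>\<one>\<close> under the syntactic congruence of \<open>K\<close>.\<close>

definition syntactic_kernel :: "'a set \<Rightarrow> 'a set" where
  "syntactic_kernel K =
     {x \<in> carrier G. \<forall>h\<in>carrier G. \<forall>g\<in>carrier G. h \<otimes> x \<otimes> g \<in> K \<longleftrightarrow> h \<otimes> g \<in> K}"

lemma syntactic_kernelI:
  assumes "x \<in> carrier G"
    and "\<And>h g. h \<in> carrier G \<Longrightarrow> g \<in> carrier G \<Longrightarrow> h \<otimes> x \<otimes> g \<in> K \<longleftrightarrow> h \<otimes> g \<in> K"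
  shows "x \<in> syntactic_kernel K"
  using assms by (simp add: syntactic_kernel_def)

lemma syntactic_kernelD:
  assumes "x \<in> syntactic_kernel K" "h \<in> carrier G" "g \<in> carrier G"
  shows "h \<otimes> x \<otimes> g \<in> K \<longleftrightarrow> h \<otimes> g \<in> K"
  using assms by (simp add: syntactic_kernel_def)

lemma syntactic_kernel_carrier: "syntactic_kernel K \<subseteq> carrier G"
  by (auto simp: syntactic_kernel_def)

lemma syntactic_kernel_subset:
  assumes "\<one> \<in> K"
  shows "syntactic_kernel K \<subseteq> K"
proof
  fix x assume x: "x \<in> syntactic_kernel K"
  then have "x \<in> carrier G"
    using syntactic_kernel_carrier by blast
  then show "x \<in> K"
    using syntactic_kernelD[OF x, of \<one> \<one>] assms by simp
qed

lemma subgroup_syntactic_kernel: "subgroup (syntactic_kernel K) G"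
proof
  note carrier = subsetD[OF syntactic_kernel_carrier]
  show "syntactic_kernel K \<subseteq> carrier G"
    by (rule syntactic_kernel_carrier)
  show "\<one> \<in> syntactic_kernel K"
    by (rule syntactic_kernelI) simp_all
  show "x \<otimes> y \<in> syntactic_kernel K"
    if xy: "x \<in> syntactic_kernel K" "y \<in> syntactic_kernel K" for x y
  proof (rule syntactic_kernelI)
    show "h \<otimes> (x \<otimes> y) \<otimes> g \<in> K \<longleftrightarrow> h \<otimes> g \<in> K" if "h \<in> carrier G" "g \<in> carrier G" for h g
      using that xy[THEN carrier] syntactic_kernelD[OF xy(1), of h g]
        syntactic_kernelD[OF xy(2), of "h \<otimes> x" g]
      by (simp add: m_assoc)
  qed (use xy[THEN carrier] in simp)
  show "inv x \<in> syntactic_kernel K" if x: "x \<in> syntactic_kernel K" for x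
  proof (rule syntactic_kernelI)
    show "h \<otimes> inv x \<otimes> g \<in> K \<longleftrightarrow> h \<otimes> g \<in> K" if "h \<in> carrier G" "g \<in> carrier G" for h g
      using that carrier[OF x] syntactic_kernelD[OF x, of "h \<otimes> inv x" g] by (simp add: m_assoc)
  qed (use carrier[OF x] in simp)
qed

lemma normal_syntactic_kernel: "syntactic_kernel K \<lhd> G"
proof -
  have "a \<otimes> x \<otimes> inv a \<in> syntactic_kernel K"
    if a: "a \<in> carrier G" and x: "x \<in> syntactic_kernel K" for a x
  proof (rule syntactic_kernelI)
    have carrier: "x \<in> carrier G"
      using x syntactic_kernel_carrier by blast
    then show "a \<otimes> x \<otimes> inv a \<in> carrier G"
      using a by simp
    fix h g assume hg: "h \<in> carrier G" "g \<in> carrier G"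
    have "h \<otimes> (a \<otimes> x \<otimes> inv a) \<otimes> g = (h \<otimes> a) \<otimes> x \<otimes> (inv a \<otimes> g)"
      using a carrier hg by (simp add: m_assoc)
    also have "\<dots> \<in> K \<longleftrightarrow> (h \<otimes> a) \<otimes> (inv a \<otimes> g) \<in> K"
      using a hg by (intro syntactic_kernelD[OF x] m_closed inv_closed)
    also have "(h \<otimes> a) \<otimes> (inv a \<otimes> g) = h \<otimes> g"
      using a hg by (metis inv_closed m_assoc m_closed r_inv r_one)
    finally show "h \<otimes> (a \<otimes> x \<otimes> inv a) \<otimes> g \<in> K \<longleftrightarrow> h \<otimes> g \<in> K" .
  qed
  then show ?thesis
    using subgroup_syntactic_kernel by (simp add: normal_inv_iff)
qed

end

section \<open>Topological groups\<close>

locale topological_group = group G for G :: "('a, 'b) monoid_scheme" (structure) +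
  fixes T :: "'a topology"
  assumes topspace_eq [simp]: "topspace T = carrier G"
    and continuous_map_m: "continuous_map (prod_topology T T) T (\<lambda>(x, y). x \<otimes> y)"
    and continuous_map_inv: "continuous_map T T (\<lambda>x. inv x)"
begin

lemma continuous_map_mult:
  assumes "continuous_map Z T f" "continuous_map Z T g"
  shows "continuous_map Z T (\<lambda>x. f x \<otimes> g x)"
  using continuous_map_compose[OF continuous_map_pairedI[OF assms] continuous_map_m]
  by (simp add: comp_def)

lemma continuous_map_r_translation:
  assumes "a \<in> carrier G"
  shows "continuous_map T T (\<lambda>x. x \<otimes> a)"
  using assms by (intro continuous_map_mult) auto

lemma r_coset_eq_vimage:
  assumes U: "U \<subseteq> carrier G" and a: "a \<in> carrier G"
  shows "U #> a = {x \<in> topspace T. x \<otimes> inv a \<in> U}"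
proof (intro equalityI subsetI)
  fix x assume "x \<in> U #> a"
  then obtain u where "u \<in> U" "x = u \<otimes> a"
    by (auto simp: r_coset_def)
  then show "x \<in> {x \<in> topspace T. x \<otimes> inv a \<in> U}"
    using U a by (auto simp: m_assoc subset_iff)
next
  fix x assume x: "x \<in> {x \<in> topspace T. x \<otimes> inv a \<in> U}"
  then have "x = (x \<otimes> inv a) \<otimes> a"
    using a by (simp add: m_assoc)
  then show "x \<in> U #> a"
    using x by (auto simp: r_coset_def)
qed

lemma openin_r_coset:
  assumes "openin T U" "a \<in> carrier G"
  shows "openin T (U #> a)"
  using openin_continuous_map_preimage[OF continuous_map_r_translation assms(1), of "inv a"]
    r_coset_eq_vimage[of U a] openin_subset[OF assms(1)] assms(2) by simp

lemma closedin_r_coset: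
  assumes "closedin T U" "a \<in> carrier G"
  shows "closedin T (U #> a)"
  using closedin_continuous_map_preimage[OF continuous_map_r_translation assms(1), of "inv a"]
    r_coset_eq_vimage[of U a] closedin_subset[OF assms(1)] assms(2) by simp

lemma openin_set_mult:
  assumes "openin T U" "Y \<subseteq> carrier G"
  shows "openin T (U <#> Y)"
proof -
  have "U <#> Y = (\<Union>y\<in>Y. U #> y)"
    by (auto simp: set_mult_def r_coset_def)
  then show ?thesis
    using openin_r_coset[OF assms(1)] assms(2) by (auto intro!: openin_Union)
qed

lemma open_subgroup_set_mult:
  assumes "N \<lhd> G" "openin T N" "subgroup C G"
  shows "open_subgroup G T (N <#> C)"
  using mult_norm_subgroup[OF assms(1,3)] openin_set_mult[OF assms(2) subgroup.subset[OF assms(3)]]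
  by (simp add: open_subgroup_def)

lemma openin_rcosets:
  assumes "openin T H" "c \<in> rcosets H"
  shows "openin T c"
  using assms openin_r_coset by (auto simp: RCOSETS_def)

lemma subgroup_complement_eq_Union_rcosets:
  assumes H: "subgroup H G"
  shows "carrier G - H = \<Union>(rcosets H - {H})"
proof -
  have "H \<in> rcosets H"
    by (rule subgroup.subgroup_in_rcosets[OF H is_group])
  then have "H \<inter> c = {}" if "c \<in> rcosets H" "c \<noteq> H" for c
    using rcos_disjoint[OF H] that by (auto simp: pairwise_def disjnt_def)
  with \<open>H \<in> rcosets H\<close> show ?thesis
    using rcosets_part_G[OF H] by blast
qed

lemma closedin_open_subgroup:
  assumes "open_subgroup G T H"
  shows "closedin T H"
proof -
  have H: "subgroup H G" "openin T H"
    using assms by (auto simp: open_subgroup_def)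
  have "openin T (carrier G - H)"
    unfolding subgroup_complement_eq_Union_rcosets[OF H(1)]
    using openin_rcosets[OF H(2)] by blast
  then show ?thesis
    using subgroup.subset[OF H(1)] by (simp add: closedin_def)
qed

lemma open_subgroup_if_finite_index:
  assumes "closed_subgroup G T H" "finite (rcosets H)"
  shows "open_subgroup G T H"
proof -
  have H: "subgroup H G" "closedin T H"
    using assms by (auto simp: closed_subgroup_def)
  have "closedin T (\<Union>(rcosets H - {H}))"
    using assms(2) closedin_r_coset[OF H(2)]
    by (intro closedin_Union) (auto simp: RCOSETS_def)
  then have "closedin T (carrier G - H)"
    by (simp only: subgroup_complement_eq_Union_rcosets[OF H(1)])
  then show ?thesis
    using H(1) subgroup.subset[OF H(1)] by (simp add: open_subgroup_def openin_closedin_eq)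
qed

lemma closed_subgroup_Int_open_subgroup:
  assumes "closed_subgroup G T A" "open_subgroup G T V"
  shows "closed_subgroup G T (A \<inter> V)"
  using assms closedin_open_subgroup[OF assms(2)] subgroups_Inter_pair
  by (auto simp: closed_subgroup_def open_subgroup_def)

lemma subgroup_closure_of:
  assumes H: "subgroup H G"
  shows "subgroup (T closure_of H) G"
proof
  let ?C = "T closure_of H"
  have HC: "H \<subseteq> ?C"
    using subgroup.subset[OF H] by (simp add: closure_of_subset)
  show "?C \<subseteq> carrier G"
    using closure_of_subset_topspace by force
  show "\<one> \<in> ?C"
    using subgroup.one_closed[OF H] HC by blast
  show "inv x \<in> ?C" if "x \<in> ?C" for x
  proof -
    have "m_inv G ` ?C \<subseteq> T closure_of (m_inv G ` H)"
      by (rule continuous_map_image_closure_subset[OF continuous_map_inv])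
    moreover have "m_inv G ` H \<subseteq> H"
      using subgroup.m_inv_closed[OF H] by blast
    ultimately show ?thesis
      using closure_of_mono that by blast
  qed
  show "x \<otimes> y \<in> ?C" if "x \<in> ?C" "y \<in> ?C" for x y
  proof -
    have "(\<lambda>(x, y). x \<otimes> y) ` (prod_topology T T closure_of (H \<times> H))
      \<subseteq> T closure_of ((\<lambda>(x, y). x \<otimes> y) ` (H \<times> H))"
      by (rule continuous_map_image_closure_subset[OF continuous_map_m])
    moreover have "(\<lambda>(x, y). x \<otimes> y) ` (H \<times> H) \<subseteq> H"
      using subgroup.m_closed[OF H] by auto
    ultimately have "(\<lambda>(x, y). x \<otimes> y) ` (?C \<times> ?C) \<subseteq> ?C"
      using closure_of_mono by (metis closure_of_Times order_trans)
    then show ?thesis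
      using that by auto
  qed
qed

definition closed_generate :: "'a set \<Rightarrow> 'a set" where
  "closed_generate S = T closure_of (generate G S)"

lemma closed_subgroup_closed_generate:
  assumes "S \<subseteq> carrier G"
  shows "closed_subgroup G T (closed_generate S)"
  using subgroup_closure_of[OF generate_is_subgroup[OF assms]]
  by (simp add: closed_subgroup_def closed_generate_def)

lemma subset_closed_generate:
  assumes "S \<subseteq> carrier G"
  shows "S \<subseteq> closed_generate S"
proof -
  have "S \<subseteq> generate G S"
    by (auto intro: generate.incl)
  also have "\<dots> \<subseteq> closed_generate S"
    using generate_incl[OF assms] by (simp add: closed_generate_def closure_of_subset)
  finally show ?thesis .
qed

lemma closed_generate_minimal:
  assumes "S \<subseteq> H" "closed_subgroup G T H"
  shows "closed_generate S \<subseteq> H"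
  unfolding closed_generate_def using assms
  by (intro closure_of_minimal generate_subgroup_incl) (auto simp: closed_subgroup_def)

lemma closed_generate_mono:
  assumes "S \<subseteq> R"
  shows "closed_generate S \<subseteq> closed_generate R"
  unfolding closed_generate_def by (intro closure_of_mono mono_generate assms)

lemma top_generates_iff: "top_generates G T S U \<longleftrightarrow> S \<subseteq> U \<and> closed_generate S = U"
  by (simp add: top_generates_def closed_generate_def)

lemma top_generates_subset:
  assumes "top_generates G T S U"
  shows "S \<subseteq> U" "U \<subseteq> carrier G"
  using assms closure_of_subset_topspace[of T] by (auto simp: top_generates_def)

lemma top_generates_Un:
  assumes A: "top_generates G T S A" and B: "top_generates G T R B"
  shows "top_generates G T (S \<union> R) (closed_generate (A \<union> B))"
proof -
  have carrier: "A \<union> B \<subseteq> carrier G" "S \<union> R \<subseteq> carrier G"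
    using top_generates_subset[OF A] top_generates_subset[OF B] by auto
  have "S \<union> R \<subseteq> A \<union> B"
    using top_generates_subset[OF A] top_generates_subset[OF B] by blast
  moreover have "A \<union> B \<subseteq> closed_generate (S \<union> R)"
    using A B closed_generate_mono[of S "S \<union> R"] closed_generate_mono[of R "S \<union> R"]
    by (auto simp: top_generates_iff)
  ultimately have "closed_generate (S \<union> R) = closed_generate (A \<union> B)"
    using closed_generate_mono closed_generate_minimal closed_subgroup_closed_generate carrier(2)
    by (metis equalityI)
  then show ?thesis
    using subset_closed_generate[OF carrier(2)] by (simp add: top_generates_iff)
qed

lemma top_rank_le:
  assumes "finite S" "top_generates G T S U"
  shows "top_rank G T U \<le> card S"
  unfolding top_rank_def using assms by (blast intro: Least_le)

lemma top_rank_generators: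
  assumes "top_fin_gen G T U"
  obtains S where "finite S" "card S = top_rank G T U" "top_generates G T S U"
proof -
  have "\<exists>n S. finite S \<and> card S = n \<and> top_generates G T S U"
    using assms by (auto simp: top_fin_gen_def)
  from LeastI_ex[OF this] show ?thesis
    using that by (auto simp: top_rank_def)
qed

lemma top_rank_closed_generate_Un_le:
  assumes "top_fin_gen G T A" "top_fin_gen G T B"
  shows "top_rank G T (closed_generate (A \<union> B)) \<le> top_rank G T A + top_rank G T B"
proof -
  obtain S where S: "finite S" "card S = top_rank G T A" "top_generates G T S A"
    using top_rank_generators[OF assms(1)] .
  obtain R where R: "finite R" "card R = top_rank G T B" "top_generates G T R B"
    using top_rank_generators[OF assms(2)] .
  have "top_rank G T (closed_generate (A \<union> B)) \<le> card (S \<union> R)"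
    using S R by (intro top_rank_le top_generates_Un) auto
  also have "\<dots> \<le> top_rank G T A + top_rank G T B"
    using card_Un_le[of S R] S R by simp
  finally show ?thesis .
qed

lemma rank_gradient_le:
  assumes "open_subgroup G T U"
  shows "rank_gradient G T \<le> (real (top_rank G T U) - 1) / real (group_index G U)"
proof -
  let ?ratio = "\<lambda>U. (real (top_rank G T U) - 1) / real (group_index G U)"
  have "- 1 \<le> ?ratio U" for U
  proof -
    have "- 1 \<le> - 1 / real (group_index G U)"
      by (cases "group_index G U") auto
    also have "\<dots> \<le> ?ratio U"
      by (intro divide_right_mono) auto
    finally show ?thesis .
  qed
  then have "bdd_below {?ratio U | U. open_subgroup G T U}"
    by (intro bdd_belowI[of _ "- 1"]) blast
  then show ?thesis
    unfolding rank_gradient_def using assms by (intro cInf_lower) auto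
qed

lemma rank_gradient_mult_index_le:
  assumes "closed_subgroup G T U" "finite (rcosets U)"
  shows "rank_gradient G T * group_index G U \<le> real (top_rank G T U) - 1"
  using rank_gradient_le[OF open_subgroup_if_finite_index[OF assms]] group_index_pos[OF assms(2)]
  by (simp add: field_simps)

end

section \<open>Compact groups\<close>

lemma openin_Ball_compact_space:
  assumes Z: "compact_space Z" and W: "openin (prod_topology Z Y) W"
  shows "openin Y {y \<in> topspace Y. \<forall>x\<in>topspace Z. (x, y) \<in> W}"
proof -
  have "closedin (prod_topology Z Y) (topspace (prod_topology Z Y) - W)"
    using W by blast
  then have "closedin Y (snd ` (topspace (prod_topology Z Y) - W))"
    using Abstract_Topological_Spaces.closed_map_snd[OF Z] by (auto simp: closed_map_def)
  moreover have "{y \<in> topspace Y. \<forall>x\<in>topspace Z. (x, y) \<in> W} =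
      topspace Y - snd ` (topspace (prod_topology Z Y) - W)"
    unfolding topspace_prod_topology by (fastforce intro: rev_image_eqI)
  ultimately show ?thesis
    by (simp add: openin_diff)
qed

locale compact_group = topological_group +
  assumes compact: "compact_space T"
begin

lemma finite_rcosets_open_subgroup:
  assumes "open_subgroup G T H"
  shows "finite (rcosets H)"
proof -
  have H: "subgroup H G" "openin T H"
    using assms by (auto simp: open_subgroup_def)
  obtain F where F: "finite F" "F \<subseteq> rcosets H" "carrier G \<subseteq> \<Union>F"
    using compact openin_rcosets[OF H(2)] rcosets_part_G[OF H(1)]
    unfolding compact_space_alt by (metis order_refl topspace_eq)
  have "rcosets H \<subseteq> F"
  proof
    fix c assume c: "c \<in> rcosets H"
    then obtain x where x: "x \<in> c" "x \<in> carrier G"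
      using rcos_self[OF _ H(1)] by (auto simp: RCOSETS_def)
    then obtain d where d: "d \<in> F" "x \<in> d"
      using F(3) by blast
    then have "c = d"
      using rcos_disjoint[OF H(1)] c F(2) x by (auto simp: pairwise_def disjnt_def)
    then show "c \<in> F"
      using d(1) by simp
  qed
  then show ?thesis
    using F(1) finite_subset by blast
qed

lemma finite_rcosets_open_normal:
  assumes "N \<lhd> G" "openin T N"
  shows "finite (rcosets N)"
  using assms finite_rcosets_open_subgroup normal_imp_subgroup by (auto simp: open_subgroup_def)

lemma openin_syntactic_kernel:
  assumes K: "openin T K" "closedin T K"
  shows "openin T (syntactic_kernel K)"
proof -
  let ?X = "prod_topology T T"
  let ?f = "\<lambda>p. fst (fst p) \<otimes> snd (fst p)" and ?g = "\<lambda>p. fst (fst p) \<otimes> snd p \<otimes> snd (fst p)"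
  have factors: "continuous_map (prod_topology ?X T) T (\<lambda>p. fst (fst p))"
    "continuous_map (prod_topology ?X T) T (\<lambda>p. snd (fst p))"
    "continuous_map (prod_topology ?X T) T snd"
    by (auto intro: continuous_map_fst continuous_map_snd
        continuous_map_fst_of[unfolded comp_def] continuous_map_snd_of[unfolded comp_def])
  have f: "continuous_map (prod_topology ?X T) T ?f"
    and g: "continuous_map (prod_topology ?X T) T ?g"
    using factors by (auto intro: continuous_map_mult)
  have co_K: "openin T (topspace T - K)"
    using K(2) by (simp add: closedin_def)
  define W where "W = {p \<in> topspace (prod_topology ?X T). ?f p \<in> K \<longleftrightarrow> ?g p \<in> K}"
  have W_eq: "W =
      ({p \<in> topspace (prod_topology ?X T). ?f p \<in> K} \<inter>
        {p \<in> topspace (prod_topology ?X T). ?g p \<in> K}) \<union>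
      ({p \<in> topspace (prod_topology ?X T). ?f p \<in> topspace T - K} \<inter>
        {p \<in> topspace (prod_topology ?X T). ?g p \<in> topspace T - K})"
    unfolding W_def by auto
  have "openin (prod_topology ?X T) W"
    unfolding W_eq
    by (intro openin_Un openin_Int openin_continuous_map_preimage[OF f]
        openin_continuous_map_preimage[OF g] K(1) co_K)
  moreover have "syntactic_kernel K = {x \<in> topspace T. \<forall>p\<in>topspace ?X. (p, x) \<in> W}"
    by (auto simp: syntactic_kernel_def W_def)
  ultimately show ?thesis
    using openin_Ball_compact_space[of ?X T W] compact by (simp add: compact_space_prod_topology)
qed

lemma top_generates_Int_open_subgroup:
  assumes S: "finite S" "top_generates G T S B" and V: "open_subgroup G T V"
  obtains S' where "finite S'" "card S' \<le> card ((#>) V ` B) * card S" "top_generates G T S' (B \<inter> V)"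
proof -
  let ?D = "generate G S"
  have subV: "subgroup V G" and openV: "openin T V"
    using V by (auto simp: open_subgroup_def)
  have BG: "B \<subseteq> carrier G" and SG: "S \<subseteq> carrier G"
    using top_generates_subset[OF S(2)] by auto
  have closure: "T closure_of ?D = B"
    using S(2) by (simp add: top_generates_def)
  have DB: "?D \<subseteq> B"
    using closure closure_of_subset[of ?D T] generate_incl[OF SG] by simp
  have finite_cosets: "finite ((#>) V ` B)" "finite ((#>) V ` ?D)"
    using finite_image_r_coset[OF finite_rcosets_open_subgroup[OF V]] BG DB by blast+
  obtain S' where S': "finite S'" "card S' \<le> card ((#>) V ` ?D) * card S" "generate G S' = ?D \<inter> V"
    using schreier_bound[OF SG S(1) subV finite_cosets(2)] .
  have "card S' \<le> card ((#>) V ` ?D) * card S"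
    by (rule S'(2))
  also have "card ((#>) V ` ?D) \<le> card ((#>) V ` B)"
    using finite_cosets(1) DB by (intro card_mono image_mono)
  finally have "card S' \<le> card ((#>) V ` B) * card S"
    by simp
  moreover have "T closure_of (?D \<inter> V) = B \<inter> V"
  proof
    show "T closure_of (?D \<inter> V) \<subseteq> B \<inter> V"
      using closure_of_mono[of "?D \<inter> V" ?D T] closure
        closure_of_minimal[OF Int_lower2 closedin_open_subgroup[OF V]] by blast
    show "B \<inter> V \<subseteq> T closure_of (?D \<inter> V)"
      using openin_Int_closure_of_subset[OF openV, of ?D] closure by (simp add: Int_commute)
  qed
  moreover have "S' \<subseteq> B \<inter> V"
    using S'(3) DB generate.incl[of _ S' G] by blast
  ultimately show ?thesis
    using that S'(1,3) by (simp add: top_generates_def)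
qed

lemma top_fin_gen_Int_open_subgroup:
  assumes "top_fin_gen G T B" "open_subgroup G T V"
  shows "top_fin_gen G T (B \<inter> V)"
  using assms(1) top_generates_Int_open_subgroup[OF _ _ assms(2)]
  unfolding top_fin_gen_def by metis

lemma top_rank_Int_open_subgroup_le:
  assumes "top_fin_gen G T B" "open_subgroup G T V"
  shows "top_rank G T (B \<inter> V) \<le> card ((#>) V ` B) * top_rank G T B"
proof -
  obtain S where S: "finite S" "card S = top_rank G T B" "top_generates G T S B"
    using top_rank_generators[OF assms(1)] .
  obtain S' where S': "finite S'" "card S' \<le> card ((#>) V ` B) * card S"
    "top_generates G T S' (B \<inter> V)"
    using top_generates_Int_open_subgroup[OF S(1,3) assms(2)] .
  then show ?thesis
    using top_rank_le[OF S'(1,3)] S(2) by simp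
qed

lemma closed_generate_Un_Int_infinite_indexI:
  assumes pos: "rank_gradient G T > 0"
    and A: "top_fin_gen G T A" and B: "top_fin_gen G T B"
    and V: "open_subgroup G T V" "A \<subseteq> V"
    and le: "top_rank G T A / group_index G V + top_rank G T B * coset_density V B
      \<le> rank_gradient G T"
  shows "infinite (rcosets (closed_generate (A \<union> (B \<inter> V))))"
proof
  let ?H = "closed_generate (A \<union> (B \<inter> V))"
  assume fin: "finite (rcosets ?H)"
  have subV: "subgroup V G" and closedV: "closed_subgroup G T V"
    using V(1) closedin_open_subgroup by (auto simp: open_subgroup_def closed_subgroup_def)
  have H: "closed_subgroup G T ?H"
    using V(2) subgroup.subset[OF subV] by (intro closed_subgroup_closed_generate) blast
  have "?H \<subseteq> V"
    using V(2) closedV by (intro closed_generate_minimal) auto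
  then have "group_index G V \<le> group_index G ?H"
    using H subV fin by (intro group_index_antimono) (auto simp: closed_subgroup_def)
  then have "rank_gradient G T * group_index G V \<le> rank_gradient G T * group_index G ?H"
    using pos by simp
  also have "\<dots> \<le> real (top_rank G T ?H) - 1"
    using H fin by (rule rank_gradient_mult_index_le)
  also have "\<dots> < real (top_rank G T A + card ((#>) V ` B) * top_rank G T B)"
    using top_rank_closed_generate_Un_le[OF A top_fin_gen_Int_open_subgroup[OF B V(1)]]
      top_rank_Int_open_subgroup_le[OF B V(1)] by linarith
  also have "\<dots> =
      (top_rank G T A / group_index G V + top_rank G T B * coset_density V B) * group_index G V"
    using group_index_pos[OF finite_rcosets_open_subgroup[OF V(1)]]
    by (simp add: coset_density_def field_simps)
  also have "\<dots> \<le> rank_gradient G T * group_index G V"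
    using le by (intro mult_right_mono) auto
  finally show False
    by simp
qed

end

section \<open>Profinite groups\<close>

locale profinite = compact_group +
  assumes Hausdorff: "Hausdorff_space T"
    and totally_disconnected: "totally_disconnected_space T"

lemma profinite_if_profinite_group:
  assumes "profinite_group G T"
  shows "profinite G T"
  using assms unfolding profinite_group_def
  by (intro profinite.intro compact_group.intro topological_group.intro
      topological_group_axioms.intro compact_group_axioms.intro profinite_axioms.intro) auto

context profinite
begin

lemma clopen_neighbourhood:
  assumes "openin T U" "x \<in> U"
  obtains K where "openin T K" "closedin T K" "x \<in> K" "K \<subseteq> U"
proof -
  have "x \<in> topspace T"
    using assms openin_subset by blast
  have "separated_between T {x} (topspace T - U)"
  proof (rule cut_wire_fence_theorem[OF compact Hausdorff])
    show "closedin T {x}"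
      using \<open>x \<in> topspace T\<close> Hausdorff by (simp add: closedin_Hausdorff_singleton)
    show "closedin T (topspace T - U)"
      using assms(1) by blast
    show "disjnt C {x} \<or> disjnt C (topspace T - U)" if "connectedin T C" for C
      using totally_disconnected that assms(2) unfolding totally_disconnected_space_def disjnt_def
      by blast
  qed
  then obtain K where "closedin T K" "openin T K" "x \<in> K" "topspace T - U \<subseteq> topspace T - K"
    unfolding separated_between by auto
  then show ?thesis
    using that openin_subset by blast
qed

lemma open_normal_subgroup_in_neighbourhood:
  assumes "openin T U" "\<one> \<in> U"
  obtains N where "N \<lhd> G" "openin T N" "N \<subseteq> U"
proof -
  obtain K where K: "openin T K" "closedin T K" "\<one> \<in> K" "K \<subseteq> U"
    using clopen_neighbourhood[OF assms] .
  show ?thesis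
    using that normal_syntactic_kernel openin_syntactic_kernel[OF K(1,2)]
      syntactic_kernel_subset[OF K(3)] K(4) by blast
qed

lemma open_normal_subgroup_set_mult_avoids_finite:
  assumes C: "closed_subgroup G T C" and F: "finite F" "F \<subseteq> carrier G" "F \<inter> C = {}"
    and U: "openin T U" "\<one> \<in> U"
  obtains N where "N \<lhd> G" "openin T N" "N \<subseteq> U" "F \<inter> (N <#> C) = {}"
proof -
  have subC: "subgroup C G" and open_compl: "openin T (topspace T - C)"
    using C by (auto simp: closed_subgroup_def closedin_def)
  define Q where "Q = U \<inter> ((\<Inter>a\<in>F. {x \<in> topspace T. x \<otimes> a \<in> topspace T - C}) \<inter> topspace T)"
  have "openin T {x \<in> topspace T. x \<otimes> a \<in> topspace T - C}" if "a \<in> F" for a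
    using that F(2) openin_continuous_map_preimage[OF continuous_map_r_translation open_compl]
    by blast
  then have "openin T Q"
    unfolding Q_def using F(1) U(1) by (intro openin_Int openin_INT)
  moreover have "\<one> \<in> Q"
    using U(2) F(2,3) by (auto simp: Q_def subset_iff disjoint_iff)
  ultimately obtain N where N: "N \<lhd> G" "openin T N" "N \<subseteq> Q"
    using open_normal_subgroup_in_neighbourhood by blast
  have subN: "subgroup N G"
    using N(1) by (rule normal_imp_subgroup)
  have "a \<notin> N <#> C" if a: "a \<in> F" for a
  proof
    assume "a \<in> N <#> C"
    then obtain n c where nc: "n \<in> N" "c \<in> C" "a = n \<otimes> c"
      by (auto simp: set_mult_def)
    have "inv n \<in> Q"
      using nc(1) N(3) subgroup.m_inv_closed[OF subN] by blast
    then have "inv n \<otimes> a \<notin> C"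
      using a by (auto simp: Q_def)
    moreover have "inv n \<otimes> a = c"
      using nc subgroup.mem_carrier[OF subN] subgroup.mem_carrier[OF subC]
      by (simp add: m_assoc[symmetric])
    ultimately show False
      using nc(2) by simp
  qed
  then have "F \<inter> (N <#> C) = {}"
    by blast
  then show ?thesis
    using that N unfolding Q_def by blast
qed

lemma open_normal_subgroup_separating_cosets:
  assumes C: "closed_subgroup G T C" and R: "finite R" "R \<subseteq> carrier G" "inj_on ((#>) C) R"
    and U: "openin T U" "\<one> \<in> U"
  obtains N where "N \<lhd> G" "openin T N" "N \<subseteq> U" "inj_on ((#>) (N <#> C)) R"
proof -
  have subC: "subgroup C G"
    using C by (simp add: closed_subgroup_def)
  define F where "F = {x \<otimes> inv y | x y. x \<in> R \<and> y \<in> R \<and> x \<noteq> y}"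
  have "F \<subseteq> (\<lambda>(x, y). x \<otimes> inv y) ` (R \<times> R)"
    by (auto simp: F_def)
  then have "finite F"
    using R(1) finite_subset by blast
  moreover have "F \<subseteq> carrier G"
    using R(2) by (auto simp: F_def)
  moreover have "x \<otimes> inv y \<notin> C" if "x \<in> R" "y \<in> R" "x \<noteq> y" for x y
    using that R(2) r_coset_eq_iff[OF subC, of x y] inj_onD[OF R(3)] by blast
  then have "F \<inter> C = {}"
    by (auto simp: F_def)
  ultimately obtain N where N: "N \<lhd> G" "openin T N" "N \<subseteq> U" "F \<inter> (N <#> C) = {}"
    using open_normal_subgroup_set_mult_avoids_finite[OF C _ _ _ U] by blast
  have "inj_on ((#>) (N <#> C)) R"
  proof (rule inj_onI, rule ccontr)
    fix x y assume xy: "x \<in> R" "y \<in> R" "(N <#> C) #> x = (N <#> C) #> y" "x \<noteq> y"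
    then have "x \<otimes> inv y \<in> N <#> C"
      using r_coset_eq_iff[OF mult_norm_subgroup[OF N(1) subC], of x y] R(2) by blast
    then show False
      using N(4) xy by (auto simp: F_def)
  qed
  then show ?thesis
    using that N(1-3) by blast
qed

lemma open_normal_subgroup_large_index:
  assumes C: "closed_subgroup G T C" "infinite (rcosets C)" and U: "openin T U" "\<one> \<in> U"
  obtains N where "N \<lhd> G" "openin T N" "N \<subseteq> U" "M \<le> group_index G (N <#> C)"
proof -
  obtain D where D: "finite D" "card D = M" "D \<subseteq> (#>) C ` carrier G"
    using infinite_arbitrarily_large[OF C(2)] unfolding rcosets_eq_image by blast
  then obtain R where R: "R \<subseteq> carrier G" "inj_on ((#>) C) R" "D = (#>) C ` R"
    by (auto simp: subset_image_inj)
  have finR: "finite R" and cardR: "card R = M"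
    using D R finite_image_iff card_image by metis+
  obtain N where N: "N \<lhd> G" "openin T N" "N \<subseteq> U" "inj_on ((#>) (N <#> C)) R"
    using open_normal_subgroup_separating_cosets[OF C(1) finR R(1,2) U] .
  have "finite (rcosets (N <#> C))"
    using C(1) N(1,2)
    by (intro finite_rcosets_open_subgroup open_subgroup_set_mult) (auto simp: closed_subgroup_def)
  then have "M \<le> group_index G (N <#> C)"
    using card_inj_on_le[OF N(4), of "rcosets (N <#> C)"] R(1) cardR
    by (auto simp: group_index_def rcosets_eq_image)
  then show ?thesis
    using that N(1-3) by blast
qed

lemma open_normal_subgroup_small_density:
  fixes c :: nat and e :: real
  assumes C: "closed_subgroup G T C" "infinite (rcosets C)" and U: "openin T U" "\<one> \<in> U"
    and e: "e > 0"
  obtains N where "N \<lhd> G" "openin T N" "N \<subseteq> U" "c * coset_density N C \<le> e"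
proof -
  obtain N where N: "N \<lhd> G" "openin T N" "N \<subseteq> U" "nat \<lceil>c / e\<rceil> \<le> group_index G (N <#> C)"
    using open_normal_subgroup_large_index[OF C U] .
  have subC: "subgroup C G"
    using C(1) by (simp add: closed_subgroup_def)
  have "group_index G (N <#> C) > 0"
    by (intro group_index_pos finite_rcosets_open_subgroup open_subgroup_set_mult N subC)
  moreover have "c / e \<le> group_index G (N <#> C)"
    using N(4) by linarith
  ultimately have "c * coset_density N C \<le> e"
    unfolding coset_density_eq_inverse_index[OF N(1) finite_rcosets_open_normal[OF N(1,2)] subC]
    using e by (simp add: field_simps)
  then show ?thesis
    using that N by blast
qed

lemma open_supergroup_large_index:
  fixes c :: nat and e :: real
  assumes C: "closed_subgroup G T C" "infinite (rcosets C)"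
    and W: "open_subgroup G T W" "C \<subseteq> W" and e: "e > 0"
  obtains V where "open_subgroup G T V" "C \<subseteq> V" "V \<subseteq> W" "c / group_index G V \<le> e"
proof -
  have subC: "subgroup C G" and subW: "subgroup W G" and openW: "openin T W"
    using C(1) W(1) by (auto simp: closed_subgroup_def open_subgroup_def)
  obtain N where N: "N \<lhd> G" "openin T N" "N \<subseteq> W" "c * coset_density N C \<le> e"
    using open_normal_subgroup_small_density[OF C openW subgroup.one_closed[OF subW] e] .
  show ?thesis
  proof
    show "open_subgroup G T (N <#> C)"
      using N(1,2) subC by (rule open_subgroup_set_mult)
    show "C \<subseteq> N <#> C"
      using set_mult_upper2[OF normal_imp_subgroup[OF N(1)] subgroup.subset[OF subC]] .
    show "N <#> C \<subseteq> W"
      using subW N(3) W(2) by (rule set_mult_least)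
    show "c / group_index G (N <#> C) \<le> e"
      using N(4) coset_density_eq_inverse_index[OF N(1) finite_rcosets_open_normal[OF N(1,2)] subC]
      by simp
  qed
qed

text \<open>Replacing \<open>G\<close> by \<open>W\<close> multiplies the rank gradient by the index of \<open>W\<close>, so that it exceeds
  the number of generators of \<open>B\<close>; the price is that \<open>A\<close> shrinks to \<open>A \<inter> W\<close>.\<close>

lemma closed_generate_Int_Un_Int_infinite_index:
  assumes pos: "rank_gradient G T > 0"
    and A: "closed_subgroup G T A" "top_fin_gen G T A" "infinite (rcosets A)"
    and B: "closed_subgroup G T B" "top_fin_gen G T B" "infinite (rcosets B)"
  obtains V W where "open_subgroup G T V" "open_subgroup G T W"
    "infinite (rcosets (closed_generate ((A \<inter> W) \<union> (B \<inter> V))))"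
proof -
  let ?\<delta> = "rank_gradient G T"
  have "open_subgroup G T (carrier G)" "B \<subseteq> carrier G"
    using B(1) subgroup_self subgroup.subset openin_topspace[of T]
    by (auto simp: open_subgroup_def closed_subgroup_def)
  then obtain W where W: "open_subgroup G T W" "B \<subseteq> W"
    "top_rank G T B / group_index G W \<le> ?\<delta> / 2"
    using open_supergroup_large_index[OF B(1,3) _ _ half_gt_zero[OF pos]] by metis
  then have subW: "subgroup W G"
    by (simp add: open_subgroup_def)
  have AW: "closed_subgroup G T (A \<inter> W)" "top_fin_gen G T (A \<inter> W)"
    using A W(1) by (auto intro: closed_subgroup_Int_open_subgroup top_fin_gen_Int_open_subgroup)
  have "infinite (rcosets (A \<inter> W))"
    using AW(1) A(1,3) finite_rcosets_supergroup[of "A \<inter> W" A] by (auto simp: closed_subgroup_def)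
  then obtain V where V: "open_subgroup G T V" "A \<inter> W \<subseteq> V" "V \<subseteq> W"
    "top_rank G T (A \<inter> W) / group_index G V \<le> ?\<delta> / 2"
    using open_supergroup_large_index[OF AW(1) _ W(1) Int_lower2 half_gt_zero[OF pos]] by metis
  have "coset_density V B \<le> coset_density V W"
    using V(1) W(2) subW
    by (intro coset_density_mono finite_rcosets_open_subgroup subgroup.subset)
  also have "\<dots> = 1 / group_index G W"
    using V(1,3) subW finite_rcosets_open_subgroup
    by (intro coset_density_subgroup) (auto simp: open_subgroup_def)
  finally have "top_rank G T B * coset_density V B \<le> top_rank G T B * (1 / group_index G W)"
    by (intro mult_left_mono) auto
  also have "\<dots> \<le> ?\<delta> / 2"
    using W(3) by simp
  finally have "top_rank G T (A \<inter> W) / group_index G V + top_rank G T B * coset_density V B \<le> ?\<delta>"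
    using V(4) by linarith
  then show ?thesis
    using that V(1) W(1) closed_generate_Un_Int_infinite_indexI[OF pos AW(2) B(2) V(1,2)] by blast
qed

lemma open_normal_subgroup_small_product_density:
  fixes c :: nat and e :: real
  assumes pos: "rank_gradient G T > 0"
    and A: "closed_subgroup G T A" "top_fin_gen G T A" "infinite (rcosets A)"
    and B: "closed_subgroup G T B" "top_fin_gen G T B" "infinite (rcosets B)"
    and e: "e > 0"
  obtains N where "N \<lhd> G" "openin T N" "c * coset_density N (A <#> B) \<le> e"
proof -
  obtain V W where V: "open_subgroup G T V" and W: "open_subgroup G T W"
    and inf: "infinite (rcosets (closed_generate ((A \<inter> W) \<union> (B \<inter> V))))"
    using closed_generate_Int_Un_Int_infinite_index[OF pos A B] .
  define H where "H = closed_generate ((A \<inter> W) \<union> (B \<inter> V))"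
  have sub: "subgroup A G" "subgroup B G" "subgroup V G" "subgroup W G"
    using A(1) B(1) V W by (auto simp: closed_subgroup_def open_subgroup_def)
  then have carrier: "(A \<inter> W) \<union> (B \<inter> V) \<subseteq> carrier G"
    using subgroup.subset by blast
  have closedH: "closed_subgroup G T H" and subset_H: "A \<inter> W \<subseteq> H" "B \<inter> V \<subseteq> H"
    using closed_subgroup_closed_generate[OF carrier] subset_closed_generate[OF carrier]
    by (simp_all add: H_def)
  then have subH: "subgroup H G"
    by (simp add: closed_subgroup_def)
  have "finite ((#>) H ` A)" "finite ((#>) H ` B)"
    using sub subH subset_H finite_rcosets_open_subgroup[OF V] finite_rcosets_open_subgroup[OF W]
    by (blast intro: finite_image_r_coset_if_Int_subset)+
  then obtain k :: nat where k: "\<And>N. N \<lhd> G \<Longrightarrow> finite (rcosets N) \<Longrightarrow>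
      coset_density N (A <#> B) \<le> k * coset_density N H"
    using coset_density_set_mult_le_multiple[OF subH sub(1) _ subgroup.subset[OF sub(2)]] by blast
  obtain N where N: "N \<lhd> G" "openin T N" "real (c * k) * coset_density N H \<le> e"
    using open_normal_subgroup_small_density[OF closedH _ openin_topspace] inf e
    by (metis H_def one_closed topspace_eq)
  have "c * coset_density N (A <#> B) \<le> c * (k * coset_density N H)"
    using k[OF N(1) finite_rcosets_open_normal[OF N(1,2)]] by (intro mult_left_mono) auto
  also have "\<dots> \<le> e"
    using N(3) by (simp add: mult.assoc)
  finally show ?thesis
    using that N(1,2) by blast
qed

lemma closed_generate_Un_Int_infinite_index:
  assumes pos: "rank_gradient G T > 0"
    and A: "closed_subgroup G T A" "top_fin_gen G T A" "infinite (rcosets A)"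
    and B: "closed_subgroup G T B" "top_fin_gen G T B" "infinite (rcosets B)"
  obtains V where "open_subgroup G T V" "infinite (rcosets (closed_generate (A \<union> (B \<inter> V))))"
proof -
  let ?\<delta> = "rank_gradient G T"
  have sub: "subgroup A G" "subgroup B G"
    using A(1) B(1) by (auto simp: closed_subgroup_def)
  note AG = subgroup.subset[OF sub(1)] and BG = subgroup.subset[OF sub(2)]
  obtain M where M: "M \<lhd> G" "openin T M" "top_rank G T B * coset_density M (A <#> B) \<le> ?\<delta> / 2"
    using open_normal_subgroup_small_product_density[OF pos A B half_gt_zero[OF pos]] .
  then have subM: "subgroup M G"
    using normal_imp_subgroup by blast
  obtain N where N: "N \<lhd> G" "openin T N" "N \<subseteq> M" "top_rank G T A * coset_density N A \<le> ?\<delta> / 2"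
    using open_normal_subgroup_small_density[OF A(1,3) M(2) subgroup.one_closed[OF subM]
        half_gt_zero[OF pos]] .
  have subN: "subgroup N G" and finN: "finite (rcosets N)"
    using N(1,2) normal_imp_subgroup finite_rcosets_open_normal by auto
  define V where "V = N <#> A"
  have V: "open_subgroup G T V" "A \<subseteq> V"
    unfolding V_def by (intro open_subgroup_set_mult set_mult_upper2 N(1,2) sub(1) subN AG)+
  have "coset_density V B = coset_density N (A <#> B)"
    unfolding V_def using N(1) finN sub(1) BG by (rule coset_density_normal_set_mult)
  also have "\<dots> \<le> coset_density M (A <#> B)"
    using subN finN subM N(3) setmult_subset_G[OF AG BG] by (rule coset_density_antimono)
  finally have "top_rank G T B * coset_density V B \<le> ?\<delta> / 2"
    using M(3) by (meson mult_left_mono of_nat_0_le_iff order_trans)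
  moreover have "top_rank G T A / group_index G V = top_rank G T A * coset_density N A"
    unfolding V_def using N(1) finN sub(1) by (simp add: coset_density_eq_inverse_index)
  ultimately have "top_rank G T A / group_index G V + top_rank G T B * coset_density V B \<le> ?\<delta>"
    using N(4) by linarith
  then show ?thesis
    using that V(1) closed_generate_Un_Int_infinite_indexI[OF pos A(2) B(2) V] by blast
qed

end

theorem theorem5p1:
  fixes \<Gamma> :: "('a, 'b) monoid_scheme" and T :: "'a topology" and A B :: "'a set"
  assumes "profinite_group \<Gamma> T"
    and "top_fin_gen \<Gamma> T (carrier \<Gamma>)"
    and "rank_gradient \<Gamma> T > 0"
    and "closed_subgroup \<Gamma> T A" and "top_fin_gen \<Gamma> T A" and "infinite (rcosets\<^bsub>\<Gamma>\<^esub> A)"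
    and "closed_subgroup \<Gamma> T B" and "top_fin_gen \<Gamma> T B" and "infinite (rcosets\<^bsub>\<Gamma>\<^esub> B)"
  shows "\<exists>B0. subgroup B0 \<Gamma> \<and> B0 \<subseteq> B \<and> openin (subtopology T B) B0 \<and>
              infinite (rcosets\<^bsub>\<Gamma>\<^esub> (T closure_of (generate \<Gamma> (A \<union> B0))))"
proof -
  interpret profinite \<Gamma> T
    using assms(1) by (rule profinite_if_profinite_group)
  obtain V where V: "open_subgroup \<Gamma> T V"
    and inf: "infinite (rcosets\<^bsub>\<Gamma>\<^esub> (closed_generate (A \<union> (B \<inter> V))))"
    using closed_generate_Un_Int_infinite_index[OF assms(3-9)] .
  have "subgroup (B \<inter> V) \<Gamma>"
    using assms(7) V subgroups_Inter_pair by (auto simp: closed_subgroup_def open_subgroup_def)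
  moreover have "openin (subtopology T B) (B \<inter> V)"
    using V by (auto simp: open_subgroup_def openin_subtopology)
  ultimately show ?thesis
    using inf unfolding closed_generate_def by blast
qed

end
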